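(* Let $\eta,\vartheta,\kappa,\varphi_1,\varphi_2$ be real-valued functions of time (defined on $[0,\infty)$). For real $0\le s\le t$ with $\eta(s)+\varphi_{1}(s)\vartheta(s)+\varphi_{2}(s)\kappa(s)\neq0$ put $\theta(s)=\frac{1}{\eta(s)+\varphi_{1}(s)\vartheta(s)+\varphi_{2}(s)\kappa(s)}$ and let $E_3^{[s,t]}$ be the three-dimensional real evolution algebra whose matrix of structural constants is $$\mathcal M_{3}^{[s,t]}=\theta(s)\begin{pmatrix} \eta(t)& \vartheta(t) & \kappa(t)\\ \varphi_{1}(s)\eta(t)& \varphi_{1}(s)\vartheta(t) & \varphi_{1}(s)\kappa(t)\\ \varphi_{2}(s)\eta(t)& \varphi_{2}(s)\vartheta(t) & \varphi_{2}(s)\kappa(t) \end{pmatrix}.$$ **I.** For given $(s,t)$, $0\le s\le t$, with $\eta(s)+\varphi_{1}(s)\vartheta(s)+\varphi_{2}(s)\kappa(s)\neq0$, $\eta(t)\neq 0$ and $\eta^{2}(t)+\varphi_{1}(s)\vartheta^{2}(t)+\varphi_{2}(s)\kappa^{2}(t)=0$, the algebra $E_3^{[s,t]}$ is isomorphic to: (a) $E_1$ if one of the following holds: 1) $\varphi_2(s)=0$, $\varphi_1(s)\vartheta(t)\kappa(t)\neq0$; 2) $\varphi_1(s)=0$, $\varphi_2(s)\vartheta(t)\kappa(t)\neq0$; 3) $\kappa(t)=\varphi_2(s)=0$, $\varphi_1(s)\vartheta(t)\neq0$; 4) $\varphi_1(s)=\vartheta(t)=0$, $\kappa(t)\varphi_2(s)\neq0$.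 (b) $E_2$ if one of the following holds: 1) $\kappa(t)=0$, $\varphi_1(s)\varphi_2(s)\vartheta(t)\neq0$, $\varphi_2(s)>0$; 2) $\vartheta(t)=0$, $\varphi_1(s)\varphi_2(s)\kappa(t)\neq0$, $\varphi_1(s)>0$; 3) $\varphi_1(s)\varphi_2(s)\vartheta(t)\kappa(t)\neq0$. (c) $E_3$ if one of the following holds: 1) $\kappa(t)=0$, $\varphi_1(s)\varphi_2(s)\vartheta(t)\neq0$, $\varphi_2(s)<0$; 2) $\vartheta(t)=0$, $\varphi_1(s)\varphi_2(s)\kappa(t)\neq0$, $\varphi_1(s)<0$. **II.** For given $(s,t)$, $0\le s\le t$, with $\eta(s)+\varphi_{1}(s)\vartheta(s)+\varphi_{2}(s)\kappa(s)\neq0$, $\eta(t)\neq 0$ and $\eta^{2}(t)+\varphi_{1}(s)\vartheta^{2}(t)+\varphi_{2}(s)\kappa^{2}(t)\neq0$, the algebra $E_3^{[s,t]}$ is isomorphic to: (d) $E_4$ if $\varphi_1(s)=0$, $\varphi_2(s)=0$. (e) $E_5$ if one of the following holds: 1) $\varphi_1(s)=0$, $\varphi_2(s)>0$; 2) $\varphi_2(s)=0$, $\varphi_1(s)>0$. (f) $E_6$ if one of the following holds: 1) $\varphi_1(s)=0$, $\varphi_2(s)<0$; 2) $\varphi_2(s)=0$, $\varphi_1(s)<0$. (g) $E_7$ if $\varphi_1(s)>0$, $\varphi_2(s)>0$. (h) $E_8$ if one of the following holds: 1) $\varphi_1(s)>0$, $\varphi_2(s)<0$, $\eta^{2}(t)+\varphi_{1}(s)\vartheta^{2}(t)+\varphi_{2}(s)\kappa^{2}(t)>0$;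 2) $\varphi_1(s)<0$, $\varphi_2(s)>0$, $\eta^{2}(t)+\varphi_{1}(s)\vartheta^{2}(t)<0$, $\eta^{2}(t)+\varphi_{1}(s)\vartheta^{2}(t)+\varphi_{2}(s)\kappa^{2}(t)>0$; 3) $\varphi_1(s)<0$, $\varphi_2(s)>0$, $\eta^{2}(t)+\varphi_{1}(s)\vartheta^{2}(t)>0$; 4) $\varphi_1(s)<0$, $\varphi_2(s)<0$, $\eta^{2}(t)+\varphi_{1}(s)\vartheta^{2}(t)>0$, $\eta^{2}(t)+\varphi_{1}(s)\vartheta^{2}(t)+\varphi_{2}(s)\kappa^{2}(t)<0$; 5) $\varphi_1(s)<0$, $\varphi_2(s)<0$, $\eta^{2}(t)+\varphi_{1}(s)\vartheta^{2}(t)<0$; 6) $\varphi_1(s)\neq0$, $\varphi_2(s)\neq0$, $\eta^{2}(t)+\varphi_{1}(s)\vartheta^{2}(t)=0$. (i) $E_9$ if one of the following holds: 1) $\varphi_1(s)>0$, $\varphi_2(s)<0$, $\eta^{2}(t)+\varphi_{1}(s)\vartheta^{2}(t)+\varphi_{2}(s)\kappa^{2}(t)<0$; 2) $\varphi_1(s)<0$, $\varphi_2(s)>0$, $\eta^{2}(t)+\varphi_{1}(s)\vartheta^{2}(t)<0$, $\eta^{2}(t)+\varphi_{1}(s)\vartheta^{2}(t)+\varphi_{2}(s)\kappa^{2}(t)<0$; 3) $\varphi_1(s)<0$, $\varphi_2(s)<0$, $\eta^{2}(t)+\varphi_{1}(s)\vartheta^{2}(t)>0$, $\eta^{2}(t)+\varphi_{1}(s)\vartheta^{2}(t)+\varphi_{2}(s)\kappa^{2}(t)>0$.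 **III.** For given $(s,t)$, $0\le s\le t$, with $\eta(s)+\varphi_{1}(s)\vartheta(s)+\varphi_{2}(s)\kappa(s)\neq0$, $\eta(t)=0$ and $\vartheta(t)\neq0$, the algebra $E_3^{[s,t]}$ is isomorphic to: (j) $E_2$ if $\varphi_2(s)\neq0$, $\kappa(t)\neq0$, $\varphi_1(s)>0$, $\varphi_{1}(s)\vartheta^{2}(t)+\varphi_{2}(s)\kappa^{2}(t)=0$. (k) $E_3$ if $\varphi_2(s)\neq0$, $\kappa(t)\neq0$, $\varphi_1(s)<0$, $\varphi_{1}(s)\vartheta^{2}(t)+\varphi_{2}(s)\kappa^{2}(t)=0$. (l) $E_5$ if one of the following holds: 1) $\varphi_2(s)=0$, $\varphi_1(s)>0$; 2) $\varphi_1(s)=0$, $\kappa(t)\neq0$, $\varphi_2(s)>0$. (m) $E_6$ if one of the following holds: 1) $\varphi_2(s)=0$, $\varphi_1(s)<0$; 2) $\varphi_1(s)=0$, $\kappa(t)\neq0$, $\varphi_2(s)<0$. (n) $E_7$ if $\varphi_1(s)>0$, $\varphi_2(s)>0$. (o) $E_8$ if one of the following holds: 1) $\varphi_1(s)<0$, $\varphi_2(s)<0$; 2) $\varphi_{1}(s)\vartheta^{2}(t)+\varphi_{2}(s)\kappa^{2}(t)>0$, $\varphi_1(s)\varphi_2(s)<0$. (p) $E_9$ if $\varphi_{1}(s)\vartheta^{2}(t)+\varphi_{2}(s)\kappa^{2}(t)<0$, $\varphi_1(s)\varphi_2(s)<0$. (q) $E_{10}$ if $\varphi_1(s)=0$,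 $\varphi_2(s)=0$. (r) $E_{11}$ if $\varphi_1(s)=0$, $\kappa(t)=0$, $\varphi_2(s)>0$. (s) $E_{12}$ if $\varphi_1(s)=0$, $\kappa(t)=0$, $\varphi_2(s)<0$.
   Context: A three-dimensional real evolution algebra with matrix of structural constants $(a_{ij})_{i,j=1}^{3}$ is the real (commutative) algebra with basis $e_1,e_2,e_3$ and multiplication $e_ie_i=\sum_{j=1}^3 a_{ij}e_j$, $e_ie_j=0$ for $i\neq j$. Isomorphism means isomorphism of algebras over $\mathbb{R}$. The algebras $E_1,\dots,E_{12}$ are the three-dimensional real evolution algebras with the following matrices of structural constants (the fixed algebra $E_3$ in this list is not to be confused with the time-dependent algebra $E_3^{[s,t]}$): $$E_1:\begin{pmatrix}1&1&0\\-1&-1&0\\0&0&0\end{pmatrix},\quad E_2:\begin{pmatrix}1&1&0\\-1&-1&0\\1&1&0\end{pmatrix},\quad E_3:\begin{pmatrix}1&1&0\\-1&-1&0\\-1&-1&0\end{pmatrix},$$ $$E_4:\begin{pmatrix}1&0&0\\0&0&0\\0&0&0\end{pmatrix},\quad E_5:\begin{pmatrix}1&0&0\\0&0&0\\1&0&0\end{pmatrix},\quad E_6:\begin{pmatrix}1&0&0\\0&0&0\\-1&0&0\end{pmatrix},$$ $$E_7:\begin{pmatrix}1&0&0\\1&0&0\\1&0&0\end{pmatrix},\quad E_8:\begin{pmatrix}1&0&0\\1&0&0\\-1&0&0\end{pmatrix},\quad E_9:\begin{pmatrix}1&0&0\\-1&0&0\\-1&0&0\end{pmatrix},$$ $$E_{10}:\begin{pmatrix}0&0&0\\0&0&0\\1&0&0\end{pmatrix},\quad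 E_{11}:\begin{pmatrix}0&0&0\\1&0&0\\1&0&0\end{pmatrix},\quad E_{12}:\begin{pmatrix}0&0&0\\1&0&0\\-1&0&0\end{pmatrix}.$$ *)

theory Defs
  imports "HOL-Analysis.Analysis"
begin

text \<open>A real algebra (not necessarily associative or unital) on a real vector space is given by
  its multiplication.\<close>

definition alg_isomorphic ::
  "('a::real_vector \<Rightarrow> 'a \<Rightarrow> 'a) \<Rightarrow> ('b::real_vector \<Rightarrow> 'b \<Rightarrow> 'b) \<Rightarrow> bool"
  where "alg_isomorphic m m' \<longleftrightarrow>
    (\<exists>f. linear f \<and> bij f \<and> (\<forall>x y. f (m x y) = m' (f x) (f y)))"

text \<open>The evolution algebra on \<open>real ^ 'n\<close> with the standard basis \<open>axis i 1\<close> as natural basis.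
  Row \<open>i\<close> of the structure matrix holds the coordinates of the square of the \<open>i\<close>-th basis vector;
  the lemmas below show that this is the unique bilinear product with the prescribed values on
  basis vectors.\<close>

definition evolution_mult :: "real ^ 'n ^ 'n \<Rightarrow> real ^ 'n \<Rightarrow> real ^ 'n \<Rightarrow> real ^ 'n"
  where "evolution_mult A x y = (\<Sum>i\<in>UNIV. (x $ i * y $ i) *\<^sub>R A $ i)"

lemma bilinear_evolution_mult: "bilinear (evolution_mult A)"
  unfolding bilinear_def evolution_mult_def
  by (auto intro!: linearI simp: algebra_simps sum.distrib scaleR_sum_right)

lemma evolution_mult_commute: "evolution_mult A x y = evolution_mult A y x"
  by (simp add: evolution_mult_def mult.commute)

lemma evolution_mult_axis:
  "evolution_mult A (axis i 1) (axis j 1) =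
    (if i = j then \<Sum>k\<in>UNIV. A $ i $ k *\<^sub>R axis k 1 else 0)"
proof -
  have "evolution_mult A (axis i 1) (axis j 1) = (if i = j then A $ i else 0)"
    by (simp add: evolution_mult_def axis_def if_distrib [of "\<lambda>c. c *\<^sub>R _"]
        if_distrib [of "\<lambda>c. c * _"] cong: if_cong)
  moreover have "A $ i = (\<Sum>k\<in>UNIV. A $ i $ k *\<^sub>R axis k 1)"
    using basis_expansion [of "A $ i"] by (simp add: scalar_mult_eq_scaleR)
  ultimately show ?thesis
    by (metis (no_types, lifting))
qed

lemma evolution_mult_unique:
  assumes "bilinear m"
    and "\<And>i j. m (axis i 1) (axis j 1) =
      (if i = j then \<Sum>k\<in>UNIV. A $ i $ k *\<^sub>R axis k 1 else 0)"
  shows "m = evolution_mult A"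
  by (rule bilinear_eq_stdbasis [OF assms(1) bilinear_evolution_mult])
    (auto simp: Basis_vec_def assms(2) evolution_mult_axis)

definition E1 where "E1 = evolution_mult
  (vector [vector [1, 1, 0], vector [-1, -1, 0], vector [0, 0, 0]] :: real^3^3)"

definition E2 where "E2 = evolution_mult
  (vector [vector [1, 1, 0], vector [-1, -1, 0], vector [1, 1, 0]] :: real^3^3)"

definition E3 where "E3 = evolution_mult
  (vector [vector [1, 1, 0], vector [-1, -1, 0], vector [-1, -1, 0]] :: real^3^3)"

definition E4 where "E4 = evolution_mult
  (vector [vector [1, 0, 0], vector [0, 0, 0], vector [0, 0, 0]] :: real^3^3)"

definition E5 where "E5 = evolution_mult
  (vector [vector [1, 0, 0], vector [0, 0, 0], vector [1, 0, 0]] :: real^3^3)"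

definition E6 where "E6 = evolution_mult
  (vector [vector [1, 0, 0], vector [0, 0, 0], vector [-1, 0, 0]] :: real^3^3)"

definition E7 where "E7 = evolution_mult
  (vector [vector [1, 0, 0], vector [1, 0, 0], vector [1, 0, 0]] :: real^3^3)"

definition E8 where "E8 = evolution_mult
  (vector [vector [1, 0, 0], vector [1, 0, 0], vector [-1, 0, 0]] :: real^3^3)"

definition E9 where "E9 = evolution_mult
  (vector [vector [1, 0, 0], vector [-1, 0, 0], vector [-1, 0, 0]] :: real^3^3)"

definition E10 where "E10 = evolution_mult
  (vector [vector [0, 0, 0], vector [0, 0, 0], vector [1, 0, 0]] :: real^3^3)"

definition E11 where "E11 = evolution_mult
  (vector [vector [0, 0, 0], vector [1, 0, 0], vector [1, 0, 0]] :: real^3^3)"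

definition E12 where "E12 = evolution_mult
  (vector [vector [0, 0, 0], vector [1, 0, 0], vector [-1, 0, 0]] :: real^3^3)"

text \<open>The time functions live on \<open>[0, \<infinity>)\<close>; they are represented by total functions,
  of which only the values at \<open>s\<close> and \<open>t\<close> enter. By the convention \<open>1 / 0 = 0\<close> the function \<open>theta\<close>
  is meaningful only where its denominator is nonzero.\<close>

definition theta ::
  "(real \<Rightarrow> real) \<Rightarrow> (real \<Rightarrow> real) \<Rightarrow> (real \<Rightarrow> real) \<Rightarrow> (real \<Rightarrow> real) \<Rightarrow> (real \<Rightarrow> real) \<Rightarrow> real \<Rightarrow> real"
  where "theta \<eta> vartheta \<kappa> \<phi>1 \<phi>2 s = 1 / (\<eta> s + \<phi>1 s * vartheta s + \<phi>2 s * \<kappa> s)"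

definition M3_st ::
  "(real \<Rightarrow> real) \<Rightarrow> (real \<Rightarrow> real) \<Rightarrow> (real \<Rightarrow> real) \<Rightarrow> (real \<Rightarrow> real) \<Rightarrow> (real \<Rightarrow> real) \<Rightarrow> real \<Rightarrow> real
    \<Rightarrow> real^3^3"
  where "M3_st \<eta> vartheta \<kappa> \<phi>1 \<phi>2 s t = theta \<eta> vartheta \<kappa> \<phi>1 \<phi>2 s *\<^sub>R
    vector [vector [\<eta> t, vartheta t, \<kappa> t],
            vector [\<phi>1 s * \<eta> t, \<phi>1 s * vartheta t, \<phi>1 s * \<kappa> t],
            vector [\<phi>2 s * \<eta> t, \<phi>2 s * vartheta t, \<phi>2 s * \<kappa> t]]"

definition E3_st ::
  "(real \<Rightarrow> real) \<Rightarrow> (real \<Rightarrow> real) \<Rightarrow> (real \<Rightarrow> real) \<Rightarrow> (real \<Rightarrow> real) \<Rightarrow> (real \<Rightarrow> real) \<Rightarrow> real \<Rightarrow> real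
    \<Rightarrow> real^3 \<Rightarrow> real^3 \<Rightarrow> real^3"
  where "E3_st \<eta> vartheta \<kappa> \<phi>1 \<phi>2 s t = evolution_mult (M3_st \<eta> vartheta \<kappa> \<phi>1 \<phi>2 s t)"

end

theory Submission
  imports Defs
begin

text \<open>
  Every row of the structure matrix is a multiple of one vector \<open>v = (\<eta>(t), vartheta(t), \<kappa>(t))\<close>, so the
  product is \<open>x y = B(x, y) v\<close> with \<open>B\<close> diagonal, and so are the products of \<open>E\<^sub>1, \<dots>, E\<^sub>1\<^sub>2\<close>.
  The isomorphism type depends only on the signature of \<open>B\<close> and on the position of \<open>v\<close>, where \<open>(B, v)\<close> may
  be replaced by \<open>(c B, v / c)\<close>. If \<open>B(v, v) \<noteq> 0\<close>, one completes \<open>v\<close> to an orthogonal basis. If \<open>v\<close>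
  is isotropic but not in the radical, reflecting it in a basis vector gives an isotropic \<open>w\<close> with
  \<open>B(v, w) \<noteq> 0\<close>, and \<open>v, w\<close> span a hyperbolic plane. In that case the sign of the form on the
  complement of the plane can be absorbed in the scaling of \<open>v\<close>; in particular \<open>E\<^sub>2\<close> and \<open>E\<^sub>3\<close> are
  isomorphic.
\<close>

section \<open>Isomorphism of algebras is symmetric and transitive\<close>

lemma alg_isomorphic_sym:
  assumes "alg_isomorphic m m'"
  shows "alg_isomorphic m' m"
proof -
  obtain f where f: "linear f" "bij f" "\<And>x y. f (m x y) = m' (f x) (f y)"
    using assms unfolding alg_isomorphic_def by blast
  have "linear (inv f)"
  proof (rule linearI)
    show "inv f (x + y) = inv f x + inv f y" for x y
      using f(1,2) by (intro inv_f_eq) (simp_all add: bij_is_inj bij_is_surj surj_f_inv_f linear_add)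
    show "inv f (c *\<^sub>R x) = c *\<^sub>R inv f x" for c x
      using f(1,2) by (intro inv_f_eq) (simp_all add: bij_is_inj bij_is_surj surj_f_inv_f linear_scale)
  qed
  moreover have "inv f (m' x y) = m (inv f x) (inv f y)" for x y
    using f(2) f(3)[of "inv f x" "inv f y"]
    by (simp add: inv_f_eq bij_is_inj bij_is_surj surj_f_inv_f)
  ultimately show ?thesis
    unfolding alg_isomorphic_def using f(2) bij_imp_bij_inv by blast
qed

lemma alg_isomorphic_trans [trans]:
  assumes "alg_isomorphic m m'" "alg_isomorphic m' m''"
  shows "alg_isomorphic m m''"
proof -
  obtain f where f: "linear f" "bij f" "\<And>x y. f (m x y) = m' (f x) (f y)"
    using assms(1) unfolding alg_isomorphic_def by blast
  obtain g where g: "linear g" "bij g" "\<And>x y. g (m' x y) = m'' (g x) (g y)"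
    using assms(2) unfolding alg_isomorphic_def by blast
  show ?thesis
    unfolding alg_isomorphic_def
    using linear_compose[OF f(1) g(1)] bij_comp[OF f(2) g(2)] f(3) g(3)
    by (intro exI[of _ "g \<circ> f"]) simp
qed

section \<open>Products with values in a line, and change of basis\<close>

definition rank_one :: "real ^ 'n \<Rightarrow> real ^ 'n \<Rightarrow> real ^ 'n \<Rightarrow> real ^ 'n \<Rightarrow> real ^ 'n"
  where "rank_one d v = evolution_mult (\<chi> i. d $ i *\<^sub>R v)"

lemma rank_one_apply: "rank_one d v x y = (\<Sum>i\<in>UNIV. d $ i * x $ i * y $ i) *\<^sub>R v"
  by (simp add: rank_one_def evolution_mult_def scaleR_sum_left mult_ac)

text \<open>The columns of \<open>P\<close> are the new basis: \<open>form\<close> says that they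
  are orthogonal for the diagonal form of \<open>d\<close> and have the values \<open>d'\<close>.
  Since \<open>P\<close> turns new coordinates into old ones, it is an isomorphism from the new
  algebra to the old one, whence the appeal to symmetry.\<close>

lemma rank_one_change_basis:
  fixes P :: "real ^ 'n ^ 'n"
  assumes "invertible P"
    and form: "\<And>j k. (\<Sum>i\<in>UNIV. d $ i * P $ i $ j * P $ i $ k) = (if j = k then d' $ j else 0)"
    and vec: "P *v v' = v"
  shows "alg_isomorphic (rank_one d v) (rank_one d' v')"
proof (rule alg_isomorphic_sym)
  have "(\<Sum>i\<in>UNIV. d $ i * (P *v x) $ i * (P *v y) $ i) = (\<Sum>i\<in>UNIV. d' $ i * x $ i * y $ i)"
    for x y
  proof -
    have "(\<Sum>i\<in>UNIV. d $ i * (P *v x) $ i * (P *v y) $ i)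
        = (\<Sum>i\<in>UNIV. \<Sum>j\<in>UNIV. \<Sum>k\<in>UNIV. x $ j * y $ k * (d $ i * P $ i $ j * P $ i $ k))"
      by (simp add: matrix_vector_mult_def sum_distrib_left sum_distrib_right mult_ac)
    also have "\<dots> = (\<Sum>j\<in>UNIV. \<Sum>i\<in>UNIV. \<Sum>k\<in>UNIV. x $ j * y $ k * (d $ i * P $ i $ j * P $ i $ k))"
      by (rule sum.swap)
    also have "\<dots> = (\<Sum>j\<in>UNIV. \<Sum>k\<in>UNIV. \<Sum>i\<in>UNIV. x $ j * y $ k * (d $ i * P $ i $ j * P $ i $ k))"
      by (rule sum.cong[OF refl], rule sum.swap)
    also have "\<dots> = (\<Sum>j\<in>UNIV. \<Sum>k\<in>UNIV. x $ j * y $ k * (if j = k then d' $ j else 0))"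
      by (simp only: form flip: sum_distrib_left)
    also have "\<dots> = (\<Sum>i\<in>UNIV. d' $ i * x $ i * y $ i)"
      by (simp add: if_distrib mult_ac cong: if_cong)
    finally show ?thesis .
  qed
  moreover have "bij ((*v) P)"
    using assms(1) by (simp add: invertible_eq_bij)
  ultimately show "alg_isomorphic (rank_one d' v') (rank_one d v)"
    unfolding alg_isomorphic_def rank_one_apply
    by (intro exI[of _ "(*v) P"]) (simp add: vec matrix_vector_mult_scaleR)
qed

section \<open>Changes of basis and rescalings in dimension three\<close>

abbreviation rank_one3 :: "real \<Rightarrow> real \<Rightarrow> real \<Rightarrow> real \<Rightarrow> real \<Rightarrow> real \<Rightarrow> real^3 \<Rightarrow> real^3 \<Rightarrow> real^3"
  where "rank_one3 p q r a b c \<equiv> rank_one (vector [p, q, r]) (vector [a, b, c])"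

lemma evolution_mult_eq_rank_one3:
  "evolution_mult (vector [vector [p * a, p * b, p * c], vector [q * a, q * b, q * c],
      vector [r * a, r * b, r * c]]) = rank_one3 p q r a b c"
  unfolding rank_one_def
  by (rule arg_cong[of _ _ evolution_mult]) (simp add: vec_eq_iff forall_3)

text \<open>Only B(x, y) v enters the product, so a scalar moves freely between B and v. The
  algebras are equal, not merely isomorphic.\<close>

lemma rank_one3_rescale:
  "rank_one3 (k * p) (k * q) (k * r) a b c = rank_one3 p q r (k * a) (k * b) (k * c)"
  by (intro ext) (simp add: rank_one_apply sum_3 vec_eq_iff forall_3 algebra_simps)

text \<open>Here x, y, z are the new basis vectors. The assumptions are, in order: their
  determinant, their orthogonality, their values under the form, and the expansion of v in them. All
  become polynomial conditions that \<open>algebra\<close> can check.\<close>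

lemma rank_one3_change_basis:
  fixes x1 x2 x3 y1 y2 y3 z1 z2 z3 :: real
  assumes "x1 * (y2 * z3 - y3 * z2) - x2 * (y1 * z3 - y3 * z1) + x3 * (y1 * z2 - y2 * z1) \<noteq> 0"
    and "p * x1 * y1 + q * x2 * y2 + r * x3 * y3 = 0"
    and "p * x1 * z1 + q * x2 * z2 + r * x3 * z3 = 0"
    and "p * y1 * z1 + q * y2 * z2 + r * y3 * z3 = 0"
    and "p * x1 * x1 + q * x2 * x2 + r * x3 * x3 = p'"
    and "p * y1 * y1 + q * y2 * y2 + r * y3 * y3 = q'"
    and "p * z1 * z1 + q * z2 * z2 + r * z3 * z3 = r'"
    and "x1 * a' + y1 * b' + z1 * c' = a"
    and "x2 * a' + y2 * b' + z2 * c' = b"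
    and "x3 * a' + y3 * b' + z3 * c' = c"
  shows "alg_isomorphic (rank_one3 p q r a b c) (rank_one3 p' q' r' a' b' c')"
proof (rule rank_one_change_basis)
  let ?P = "vector [vector [x1, y1, z1], vector [x2, y2, z2], vector [x3, y3, z3]] :: real^3^3"
  show "invertible ?P"
    using assms(1) by (simp add: invertible_det_nz det_3 algebra_simps)
  have "\<forall>j k. (\<Sum>i\<in>UNIV. (vector [p, q, r] :: real^3) $ i * ?P $ i $ j * ?P $ i $ k)
      = (if j = k then (vector [p', q', r'] :: real^3) $ j else 0)"
    using assms(2-7) by (simp add: forall_3 sum_3 mult_ac)
  then show "(\<Sum>i\<in>UNIV. (vector [p, q, r] :: real^3) $ i * ?P $ i $ j * ?P $ i $ k)
      = (if j = k then (vector [p', q', r'] :: real^3) $ j else 0)" for j k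
    by blast
  show "?P *v vector [a', b', c'] = vector [a, b, c]"
    using assms(8-10) by (simp add: vec_eq_iff forall_3 matrix_vector_mult_def sum_3)
qed

lemma rank_one3_swap12: "alg_isomorphic (rank_one3 p q r a b c) (rank_one3 q p r b a c)"
  by (rule rank_one3_change_basis[where ?x1.0 = 0 and ?x2.0 = 1 and ?x3.0 = 0
        and ?y1.0 = 1 and ?y2.0 = 0 and ?y3.0 = 0 and ?z1.0 = 0 and ?z2.0 = 0 and ?z3.0 = 1]) auto

lemma rank_one3_swap23: "alg_isomorphic (rank_one3 p q r a b c) (rank_one3 p r q a c b)"
  by (rule rank_one3_change_basis[where ?x1.0 = 1 and ?x2.0 = 0 and ?x3.0 = 0
        and ?y1.0 = 0 and ?y2.0 = 0 and ?y3.0 = 1 and ?z1.0 = 0 and ?z2.0 = 1 and ?z3.0 = 0]) auto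

text \<open>Dividing the basis by \<open>k\<close> divides the form by k^2 and multiplies the
  coordinates of v by \<open>k\<close>; moving the remaining factor 1/k from the form to v restores
  v. This disposes of the factor \<theta>(s), whatever its sign.\<close>

lemma rank_one3_scale_form:
  assumes "k \<noteq> 0"
  shows "alg_isomorphic (rank_one3 (k * p) (k * q) (k * r) a b c) (rank_one3 p q r a b c)"
proof -
  have "alg_isomorphic (rank_one3 (k * p) (k * q) (k * r) a b c)
      (rank_one3 (1/k * p) (1/k * q) (1/k * r) (k * a) (k * b) (k * c))"
    using assms
    by (intro rank_one3_change_basis[where ?x1.0 = "1/k" and ?x2.0 = 0 and ?x3.0 = 0 and ?y1.0 = 0
          and ?y2.0 = "1/k" and ?y3.0 = 0 and ?z1.0 = 0 and ?z2.0 = 0 and ?z3.0 = "1/k"]) auto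
  then show ?thesis
    using assms by (subst (asm) rank_one3_rescale) auto
qed

text \<open>As v lies on the first basis vector, the other two can be scaled without affecting
  it.\<close>

lemma rank_one3_sgn:
  "alg_isomorphic (rank_one3 p y z a 0 0) (rank_one3 p (sgn y) (sgn z) a 0 0)"
proof -
  \<comment> \<open>The value 1 at 0 keeps the change of basis invertible when a coefficient
    vanishes.\<close>
  define f where "f u = (if u = 0 then 1 else 1 / sqrt \<bar>u\<bar>)" for u :: real
  have f: "u * f u * f u = sgn u" "f u \<noteq> 0" for u
    by (auto simp: f_def sgn_if real_div_sqrt divide_simps)
  show ?thesis
    by (rule rank_one3_change_basis[where ?x1.0 = 1 and ?x2.0 = 0 and ?x3.0 = 0 and ?y1.0 = 0
          and ?y2.0 = "f y" and ?y3.0 = 0 and ?z1.0 = 0 and ?z2.0 = 0 and ?z3.0 = "f z"])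
      (use f in auto)
qed

section \<open>Normal form when B(v, v) is nonzero\<close>

lemma rank_one3_nonisotropic:
  fixes p q r a b c :: real
  defines "Q12 \<equiv> p * a\<^sup>2 + q * b\<^sup>2" and "Q \<equiv> p * a\<^sup>2 + q * b\<^sup>2 + r * c\<^sup>2"
  assumes "Q12 \<noteq> 0" "Q \<noteq> 0"
  shows "alg_isomorphic (rank_one3 p q r a b c)
    (rank_one3 1 (sgn (p * q * Q12 * Q)) (sgn (r * Q12)) 1 0 0)"
proof -
  define j where "j = 1 / Q"
  have Q: "Q = p * a * a + q * b * b + r * c * c" and Q12: "Q12 = p * a * a + q * b * b"
    and j: "j * Q = 1"
    using assms(4) by (simp_all add: Q_def Q12_def j_def power2_eq_square)
  \<comment> \<open>The first new vector is v / Q, with value 1 / Q and coefficient \<open>Q\<close>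
    in v, so that moving one factor \<open>Q\<close> normalises both to 1. The second is orthogonal
    to v within the plane of the first two basis vectors, the third is orthogonal to both. The
    determinant is - \<open>Q12\<close>.\<close>
  have "alg_isomorphic (rank_one3 p q r a b c) (rank_one3 j (p * q * Q12) (r * Q12 * Q) Q 0 0)"
  proof (rule rank_one3_change_basis[where ?x1.0 = "j * a" and ?x2.0 = "j * b" and ?x3.0 = "j * c"
        and ?y1.0 = "- q * b" and ?y2.0 = "p * a" and ?y3.0 = 0
        and ?z1.0 = "r * a * c" and ?z2.0 = "r * b * c" and ?z3.0 = "- Q12"])
    have "(j * a) * (p * a * - Q12 - 0 * (r * b * c)) - (j * b) * (- q * b * - Q12 - 0 * (r * a * c))
        + (j * c) * (- q * b * (r * b * c) - p * a * (r * a * c)) = - Q12"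
      using Q Q12 j by algebra
    then show "(j * a) * (p * a * - Q12 - 0 * (r * b * c)) - (j * b) * (- q * b * - Q12 - 0 * (r * a * c))
        + (j * c) * (- q * b * (r * b * c) - p * a * (r * a * c)) \<noteq> 0"
      using assms(3) by simp
  qed (algebra | use Q Q12 j in algebra)+
  also have "rank_one3 j (p * q * Q12) (r * Q12 * Q) Q 0 0
      = rank_one3 1 (p * q * Q12 * Q) (r * Q12 * Q * Q) 1 0 0"
    using rank_one3_rescale[of Q "1 / Q" "p * q * Q12" "r * Q12 * Q" 1 0 0] assms(4)
    by (simp add: j_def mult_ac)
  also have "alg_isomorphic \<dots>
      (rank_one3 1 (sgn (p * q * Q12 * Q)) (sgn (r * Q12 * Q * Q)) 1 0 0)"
    by (rule rank_one3_sgn)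
  also have "sgn (r * Q12 * Q * Q) = sgn (r * Q12)"
    using assms(4) by (simp add: sgn_mult mult.assoc)
  finally show ?thesis .
qed

text \<open>\<open>y\<close> and \<open>z\<close> carry the signature of \<open>B / B(v, v)\<close> on the orthogonal complement of \<open>v\<close>.\<close>

lemma rank_one3_nonisotropic_signature:
  fixes p q r a b c :: real
  defines "Q \<equiv> p * a\<^sup>2 + q * b\<^sup>2 + r * c\<^sup>2"
  assumes "Q \<noteq> 0"
  shows "\<exists>y z. alg_isomorphic (rank_one3 p q r a b c) (rank_one3 1 (sgn y) (sgn z) 1 0 0)
    \<and> sgn (y * z) = sgn (p * q * r * Q)
    \<and> (y > 0 \<and> z > 0 \<longleftrightarrow> p * Q > 0 \<and> q * Q > 0 \<and> r * Q > 0)"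
proof -
  \<comment> \<open>The case of nonzero \<open>Q12\<close>, stated for all coefficients so that it
    can be applied after a permutation of the basis.\<close>
  have main: "\<exists>y z. alg_isomorphic (rank_one3 p q r a b c) (rank_one3 1 (sgn y) (sgn z) 1 0 0)
      \<and> sgn (y * z) = sgn (p * q * r * Q)
      \<and> (y > 0 \<and> z > 0 \<longleftrightarrow> p * Q > 0 \<and> q * Q > 0 \<and> r * Q > 0)"
    if Q: "Q = p * a\<^sup>2 + q * b\<^sup>2 + r * c\<^sup>2" "Q \<noteq> 0" and Q12: "p * a\<^sup>2 + q * b\<^sup>2 \<noteq> 0"
    for p q r a b c Q :: real
  proof (intro exI conjI)
    define R where "R = p * a\<^sup>2 + q * b\<^sup>2"
    show "alg_isomorphic (rank_one3 p q r a b c)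
        (rank_one3 1 (sgn (p * q * R * Q)) (sgn (r * R)) 1 0 0)"
      using rank_one3_nonisotropic[of p a q b r c] Q Q12 by (simp add: R_def)
    have R: "R \<noteq> 0" "Q = R + r * c\<^sup>2"
      using Q Q12 by (auto simp: R_def)
    show "sgn (p * q * R * Q * (r * R)) = sgn (p * q * r * Q)"
    proof -
      have "p * q * R * Q * (r * R) = p * q * r * Q * (R * R)"
        by simp
      then show ?thesis
        using R(1) by (simp only: sgn_mult) simp
    qed
    \<comment> \<open>These inequalities reduce the last equivalence to signs: if \<open>r\<close>
      and \<open>R\<close> have the same sign then so does \<open>Q\<close>, hence p q > 0, and the
      common sign of \<open>p\<close> and \<open>q\<close> is that of \<open>R\<close>.\<close>
    have pos: "R \<ge> 0" if "p \<ge> 0" "q \<ge> 0"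
      using that by (simp add: R_def)
    have neg: "R \<le> 0" if "p \<le> 0" "q \<le> 0"
      using that by (simp add: R_def mult_nonpos_nonneg add_nonpos_nonpos)
    have rpos: "Q \<ge> R" if "r \<ge> 0"
      using that by (simp add: R)
    have rneg: "Q \<le> R" if "r \<le> 0"
      using that by (simp add: R mult_nonpos_nonneg)
    show "p * q * R * Q > 0 \<and> r * R > 0 \<longleftrightarrow> p * Q > 0 \<and> q * Q > 0 \<and> r * Q > 0"
      using R(1) Q(2) pos neg rpos rneg
      by (simp add: zero_less_mult_iff mult_less_0_iff) linarith
  qed
  \<comment> \<open>The three pairwise sums add up to 2 Q, so they cannot all vanish.\<close>
  consider "p * a\<^sup>2 + q * b\<^sup>2 \<noteq> 0" | "p * a\<^sup>2 + r * c\<^sup>2 \<noteq> 0" | "q * b\<^sup>2 + r * c\<^sup>2 \<noteq> 0"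
    using assms unfolding Q_def by linarith
  then show ?thesis
  proof cases
    case 1
    then show ?thesis
      using main[of Q p a q b r c] assms by simp
  next
    case 2
    then obtain y z where yz: "alg_isomorphic (rank_one3 p r q a c b) (rank_one3 1 (sgn y) (sgn z) 1 0 0)"
      "sgn (y * z) = sgn (p * r * q * Q)"
      "y > 0 \<and> z > 0 \<longleftrightarrow> p * Q > 0 \<and> r * Q > 0 \<and> q * Q > 0"
      using main[of Q p a r c q b] assms by auto
    show ?thesis
      using alg_isomorphic_trans[OF rank_one3_swap23 yz(1)] yz(2,3)
      by - (rule exI[of _ y], rule exI[of _ z], auto simp: mult_ac)
  next
    case 3
    then obtain y z where yz: "alg_isomorphic (rank_one3 q r p b c a) (rank_one3 1 (sgn y) (sgn z) 1 0 0)"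
      "sgn (y * z) = sgn (q * r * p * Q)"
      "y > 0 \<and> z > 0 \<longleftrightarrow> q * Q > 0 \<and> r * Q > 0 \<and> p * Q > 0"
      using main[of Q q b r c p a] assms by auto
    show ?thesis
      using alg_isomorphic_trans[OF rank_one3_swap12 alg_isomorphic_trans[OF rank_one3_swap23 yz(1)]] yz(2,3)
      by - (rule exI[of _ y], rule exI[of _ z], auto simp: mult_ac)
  qed
qed

section \<open>The twelve algebras as normal forms, and the isotropic case\<close>

text \<open>The three positions of v: isotropic but outside the radical in \<open>E1\<close> to
  \<open>E3\<close>, nonisotropic in \<open>E4\<close> to \<open>E9\<close>, in the radical in
  \<open>E10\<close> to \<open>E12\<close>.\<close>

lemma E1_eq: "E1 = rank_one3 1 (-1) 0 1 1 0"
  and E2_eq: "E2 = rank_one3 1 (-1) 1 1 1 0"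
  and E3_eq: "E3 = rank_one3 1 (-1) (-1) 1 1 0"
  and E4_eq: "E4 = rank_one3 1 0 0 1 0 0"
  and E5_eq: "E5 = rank_one3 1 0 1 1 0 0"
  and E6_eq: "E6 = rank_one3 1 0 (-1) 1 0 0"
  and E7_eq: "E7 = rank_one3 1 1 1 1 0 0"
  and E8_eq: "E8 = rank_one3 1 1 (-1) 1 0 0"
  and E9_eq: "E9 = rank_one3 1 (-1) (-1) 1 0 0"
  and E10_eq: "E10 = rank_one3 0 0 1 1 0 0"
  and E11_eq: "E11 = rank_one3 0 1 1 1 0 0"
  and E12_eq: "E12 = rank_one3 0 1 (-1) 1 0 0"
  by (simp_all add: E1_def E2_def E3_def E4_def E5_def E6_def E7_def E8_def E9_def E10_def E11_def
      E12_def flip: evolution_mult_eq_rank_one3)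

text \<open>The scale \<open>k\<close> of \<open>v\<close> is free, and its sign decides between \<open>E\<^sub>2\<close> and \<open>E\<^sub>3\<close>.\<close>

lemma rank_one3_isotropic:
  assumes "p * a\<^sup>2 + q * b\<^sup>2 + r * c\<^sup>2 = 0" "p \<noteq> 0" "a \<noteq> 0" "k \<noteq> 0"
  shows "alg_isomorphic (rank_one3 p q r a b c)
    (rank_one3 1 (-1) (- (p * q * r * a\<^sup>2) / k) 1 1 0)"
proof -
  \<comment> \<open>With w = (-a, b, c) one has B(v, w) = -2 p a^2, so \<beta> is chosen to make
    B(v, \<beta> w) = 1/2 + 0 \<cdot> k + 1/2, that is, 1.\<close>
  define h \<beta> l where "h = k / 2" and "\<beta> = - 1 / (2 * p * a * a)" and "l = 1 / k"
  have \<beta>: "2 * p * a * a * \<beta> = - 1"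
    using assms by (simp add: \<beta>_def)
  have Q: "p * a * a + q * b * b + r * c * c = 0"
    using assms by (auto simp: power2_eq_square)
  have h: "k = 2 * h" and l: "2 * h * l = 1"
    using assms by (auto simp: h_def l_def)
  \<comment> \<open>The new basis is h v + \<beta> w, h v - \<beta> w and (0, -r c, q b). The first
    two are orthogonal with values \<open>k\<close> and \<open>-k\<close>, and their sum is k v; the
    third is orthogonal to both v and w.\<close>
  have "alg_isomorphic (rank_one3 p q r a b c) (rank_one3 k (-k) (- (p * q * r * a\<^sup>2)) l l 0)"
  proof (rule rank_one3_change_basis[where ?x1.0 = "h * a - \<beta> * a" and ?x2.0 = "h * b + \<beta> * b"
        and ?x3.0 = "h * c + \<beta> * c" and ?y1.0 = "h * a + \<beta> * a" and ?y2.0 = "h * b - \<beta> * b"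
        and ?y3.0 = "h * c - \<beta> * c" and ?z1.0 = 0 and ?z2.0 = "- r * c" and ?z3.0 = "q * b"])
    have "(h * a - \<beta> * a) * ((h * b - \<beta> * b) * (q * b) - (h * c - \<beta> * c) * (- r * c))
      - (h * b + \<beta> * b) * ((h * a + \<beta> * a) * (q * b) - (h * c - \<beta> * c) * 0)
      + (h * c + \<beta> * c) * ((h * a + \<beta> * a) * (- r * c) - (h * b - \<beta> * b) * 0) = - 2 * h * a"
      using Q \<beta> by algebra
    then show "(h * a - \<beta> * a) * ((h * b - \<beta> * b) * (q * b) - (h * c - \<beta> * c) * (- r * c))
      - (h * b + \<beta> * b) * ((h * a + \<beta> * a) * (q * b) - (h * c - \<beta> * c) * 0)
      + (h * c + \<beta> * c) * ((h * a + \<beta> * a) * (- r * c) - (h * b - \<beta> * b) * 0) \<noteq> 0"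
      using assms by (simp add: h_def)
  qed (use Q \<beta> h l in algebra)+
  also have "rank_one3 k (-k) (- (p * q * r * a\<^sup>2)) l l 0
      = rank_one3 1 (-1) (- (p * q * r * a\<^sup>2) / k) 1 1 0"
    using rank_one3_rescale[of k 1 "-1" "- (p * q * r * a\<^sup>2) / k" l l 0] assms(4)
    by (simp add: l_def)
  finally show ?thesis .
qed

section \<open>Criteria for the individual algebras\<close>

lemma iso_E1:
  assumes "p * a\<^sup>2 + q * b\<^sup>2 = 0" "p \<noteq> 0" "a \<noteq> 0"
  shows "alg_isomorphic (rank_one3 p q 0 a b c) E1"
  using rank_one3_isotropic[of p a q b 0 c 1] assms by (simp add: E1_eq)

text \<open>Both choices of sign for k = \<plusminus> p q r a^2 are allowed, and they turn the third
  coefficient into -1 or 1.\<close>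

lemma iso_E2_E3:
  assumes "p * a\<^sup>2 + q * b\<^sup>2 + r * c\<^sup>2 = 0" "p \<noteq> 0" "q \<noteq> 0" "r \<noteq> 0" "a \<noteq> 0"
  shows "alg_isomorphic (rank_one3 p q r a b c) E2"
    and "alg_isomorphic (rank_one3 p q r a b c) E3"
  using rank_one3_isotropic[OF assms(1,2,5), of "- (p * q * r * a\<^sup>2)"]
    rank_one3_isotropic[OF assms(1,2,5), of "p * q * r * a\<^sup>2"] assms
  by (simp_all add: E2_eq E3_eq)

text \<open>For r = 0 the values \<open>Q12\<close> and \<open>Q\<close> coincide, so only the sign
  of p q survives; the swap puts it in the third place, as in \<open>E4\<close> to
  \<open>E6\<close>.\<close>

lemma iso_nonisotropic_degenerate:
  assumes "p * a\<^sup>2 + q * b\<^sup>2 \<noteq> 0"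
  shows "alg_isomorphic (rank_one3 p q 0 a b c) (rank_one3 1 0 (sgn (p * q)) 1 0 0)"
proof -
  have "alg_isomorphic (rank_one3 p q 0 a b c) (rank_one3 1 (sgn (p * q)) 0 1 0 0)"
    using rank_one3_nonisotropic[of p a q b 0 c] assms by (simp add: sgn_mult mult.assoc)
  then show ?thesis
    by (rule alg_isomorphic_trans[OF _ rank_one3_swap23])
qed

text \<open>The condition r c = 0 places v in the radical, and b \<noteq> 0 lets p v replace the
  second basis vector. The factor \<open>p\<close> is there for the rescaling that follows.\<close>

lemma iso_radical:
  assumes "p \<noteq> 0" "b \<noteq> 0" "r * c = 0"
  shows "alg_isomorphic (rank_one3 p 0 r 0 b c) (rank_one3 0 1 (sgn (p * r)) 1 0 0)"
proof -
  have "alg_isomorphic (rank_one3 p 0 r 0 b c) (rank_one3 0 p r (1 / p) 0 0)"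
    by (rule rank_one3_change_basis[where ?x1.0 = 0 and ?x2.0 = "p * b" and ?x3.0 = "p * c"
          and ?y1.0 = 1 and ?y2.0 = 0 and ?y3.0 = 0 and ?z1.0 = 0 and ?z2.0 = 0 and ?z3.0 = 1])
      (use assms in auto)
  also have "rank_one3 0 p r (1 / p) 0 0 = rank_one3 0 1 (r / p) 1 0 0"
    using rank_one3_rescale[of p 0 1 "r / p" "1 / p" 0 0] assms(1) by simp
  also have "alg_isomorphic \<dots> (rank_one3 0 (sgn 1) (sgn (r / p)) 1 0 0)"
    by (rule rank_one3_sgn)
  also have "rank_one3 0 (sgn 1) (sgn (r / p)) 1 0 0 = rank_one3 0 1 (sgn (p * r)) 1 0 0"
    using assms(1) by (cases "p > 0") (auto simp: sgn_mult)
  finally show ?thesis .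
qed

lemma iso_E7:
  fixes p q r a b c :: real
  defines "Q \<equiv> p * a\<^sup>2 + q * b\<^sup>2 + r * c\<^sup>2"
  assumes "p * Q > 0" "q * Q > 0" "r * Q > 0"
  shows "alg_isomorphic (rank_one3 p q r a b c) E7"
proof -
  have "Q \<noteq> 0"
    using assms by auto
  then obtain y z where "alg_isomorphic (rank_one3 p q r a b c) (rank_one3 1 (sgn y) (sgn z) 1 0 0)"
    "y > 0 \<and> z > 0"
    using rank_one3_nonisotropic_signature[of p a q b r c] assms(2-) unfolding Q_def by blast
  then show ?thesis
    by (simp add: E7_eq)
qed

text \<open>The sign of p q r Q is that of the determinant of B / B(v, v) on the complement of v.
  Negative means indefinite there, which is \<open>E8\<close> up to order.\<close>

lemma iso_E8:
  fixes p q r a b c :: real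
  assumes "p * q * r * (p * a\<^sup>2 + q * b\<^sup>2 + r * c\<^sup>2) < 0"
  shows "alg_isomorphic (rank_one3 p q r a b c) E8"
proof -
  have "p * a\<^sup>2 + q * b\<^sup>2 + r * c\<^sup>2 \<noteq> 0"
    using assms by (metis less_irrefl mult_zero_right)
  then obtain y z where iso: "alg_isomorphic (rank_one3 p q r a b c) (rank_one3 1 (sgn y) (sgn z) 1 0 0)"
    and "sgn (y * z) = sgn (p * q * r * (p * a\<^sup>2 + q * b\<^sup>2 + r * c\<^sup>2))"
    using rank_one3_nonisotropic_signature[of p a q b r c] by blast
  then have "y * z < 0"
    using assms by (simp add: sgn_1_neg)
  then consider "y > 0" "z < 0" | "y < 0" "z > 0"
    by (auto simp: mult_less_0_iff)
  then show ?thesis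
  proof cases
    case 1
    then show ?thesis
      using iso by (simp add: E8_eq)
  next
    case 2
    then show ?thesis
      using alg_isomorphic_trans[OF iso rank_one3_swap23] by (simp add: E8_eq)
  qed
qed

text \<open>A positive determinant makes the form on the complement definite; the second condition
  excludes the positive definite case.\<close>

lemma iso_E9:
  fixes p q r a b c :: real
  defines "Q \<equiv> p * a\<^sup>2 + q * b\<^sup>2 + r * c\<^sup>2"
  assumes "p * q * r * Q > 0" "\<not> (p * Q > 0 \<and> q * Q > 0 \<and> r * Q > 0)"
  shows "alg_isomorphic (rank_one3 p q r a b c) E9"
proof -
  have "Q \<noteq> 0"
    using assms(2) by auto
  then obtain y z where iso: "alg_isomorphic (rank_one3 p q r a b c) (rank_one3 1 (sgn y) (sgn z) 1 0 0)"
    and "sgn (y * z) = sgn (p * q * r * Q)" "\<not> (y > 0 \<and> z > 0)"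
    using rank_one3_nonisotropic_signature[of p a q b r c] assms(3) unfolding Q_def by blast
  moreover from this have "y * z > 0"
    using assms(2) by (simp add: sgn_1_pos)
  ultimately show ?thesis
    by (auto simp: E9_eq zero_less_mult_iff)
qed

section \<open>Reduction of the classification to sign conditions\<close>

theorem theorem3:
  fixes \<eta> vartheta \<kappa> \<phi>1 \<phi>2 :: "real \<Rightarrow> real" and s t :: real
  assumes "0 \<le> s" and "s \<le> t"
    and "\<eta> s + \<phi>1 s * vartheta s + \<phi>2 s * \<kappa> s \<noteq> 0"
  shows "
   (\<eta> t \<noteq> 0 \<and> (\<eta> t)^2 + \<phi>1 s * (vartheta t)^2 + \<phi>2 s * (\<kappa> t)^2 = 0 \<longrightarrow>
      (((\<phi>2 s = 0 \<and> \<phi>1 s * vartheta t * \<kappa> t \<noteq> 0)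
        \<or> (\<phi>1 s = 0 \<and> \<phi>2 s * vartheta t * \<kappa> t \<noteq> 0)
        \<or> (\<kappa> t = 0 \<and> \<phi>2 s = 0 \<and> \<phi>1 s * vartheta t \<noteq> 0)
        \<or> (\<phi>1 s = 0 \<and> vartheta t = 0 \<and> \<kappa> t * \<phi>2 s \<noteq> 0))
         \<longrightarrow> alg_isomorphic (E3_st \<eta> vartheta \<kappa> \<phi>1 \<phi>2 s t) E1) \<and>
      (((\<kappa> t = 0 \<and> \<phi>1 s * \<phi>2 s * vartheta t \<noteq> 0 \<and> \<phi>2 s > 0)
        \<or> (vartheta t = 0 \<and> \<phi>1 s * \<phi>2 s * \<kappa> t \<noteq> 0 \<and> \<phi>1 s > 0)
        \<or> (\<phi>1 s * \<phi>2 s * vartheta t * \<kappa> t \<noteq> 0))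
         \<longrightarrow> alg_isomorphic (E3_st \<eta> vartheta \<kappa> \<phi>1 \<phi>2 s t) E2) \<and>
      (((\<kappa> t = 0 \<and> \<phi>1 s * \<phi>2 s * vartheta t \<noteq> 0 \<and> \<phi>2 s < 0)
        \<or> (vartheta t = 0 \<and> \<phi>1 s * \<phi>2 s * \<kappa> t \<noteq> 0 \<and> \<phi>1 s < 0))
         \<longrightarrow> alg_isomorphic (E3_st \<eta> vartheta \<kappa> \<phi>1 \<phi>2 s t) E3)) \<and>
   (\<eta> t \<noteq> 0 \<and> (\<eta> t)^2 + \<phi>1 s * (vartheta t)^2 + \<phi>2 s * (\<kappa> t)^2 \<noteq> 0 \<longrightarrow>
      (\<phi>1 s = 0 \<and> \<phi>2 s = 0
         \<longrightarrow> alg_isomorphic (E3_st \<eta> vartheta \<kappa> \<phi>1 \<phi>2 s t) E4) \<and>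
      (((\<phi>1 s = 0 \<and> \<phi>2 s > 0)
        \<or> (\<phi>2 s = 0 \<and> \<phi>1 s > 0))
         \<longrightarrow> alg_isomorphic (E3_st \<eta> vartheta \<kappa> \<phi>1 \<phi>2 s t) E5) \<and>
      (((\<phi>1 s = 0 \<and> \<phi>2 s < 0)
        \<or> (\<phi>2 s = 0 \<and> \<phi>1 s < 0))
         \<longrightarrow> alg_isomorphic (E3_st \<eta> vartheta \<kappa> \<phi>1 \<phi>2 s t) E6) \<and>
      (\<phi>1 s > 0 \<and> \<phi>2 s > 0
         \<longrightarrow> alg_isomorphic (E3_st \<eta> vartheta \<kappa> \<phi>1 \<phi>2 s t) E7) \<and>
      (((\<phi>1 s > 0 \<and> \<phi>2 s < 0 \<and> (\<eta> t)^2 + \<phi>1 s * (vartheta t)^2 + \<phi>2 s * (\<kappa> t)^2 > 0)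
        \<or> (\<phi>1 s < 0 \<and> \<phi>2 s > 0 \<and> (\<eta> t)^2 + \<phi>1 s * (vartheta t)^2 < 0 \<and> (\<eta> t)^2 + \<phi>1 s * (vartheta t)^2 + \<phi>2 s * (\<kappa> t)^2 > 0)
        \<or> (\<phi>1 s < 0 \<and> \<phi>2 s > 0 \<and> (\<eta> t)^2 + \<phi>1 s * (vartheta t)^2 > 0)
        \<or> (\<phi>1 s < 0 \<and> \<phi>2 s < 0 \<and> (\<eta> t)^2 + \<phi>1 s * (vartheta t)^2 > 0 \<and> (\<eta> t)^2 + \<phi>1 s * (vartheta t)^2 + \<phi>2 s * (\<kappa> t)^2 < 0)
        \<or> (\<phi>1 s < 0 \<and> \<phi>2 s < 0 \<and> (\<eta> t)^2 + \<phi>1 s * (vartheta t)^2 < 0)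
        \<or> (\<phi>1 s \<noteq> 0 \<and> \<phi>2 s \<noteq> 0 \<and> (\<eta> t)^2 + \<phi>1 s * (vartheta t)^2 = 0))
         \<longrightarrow> alg_isomorphic (E3_st \<eta> vartheta \<kappa> \<phi>1 \<phi>2 s t) E8) \<and>
      (((\<phi>1 s > 0 \<and> \<phi>2 s < 0 \<and> (\<eta> t)^2 + \<phi>1 s * (vartheta t)^2 + \<phi>2 s * (\<kappa> t)^2 < 0)
        \<or> (\<phi>1 s < 0 \<and> \<phi>2 s > 0 \<and> (\<eta> t)^2 + \<phi>1 s * (vartheta t)^2 < 0 \<and> (\<eta> t)^2 + \<phi>1 s * (vartheta t)^2 + \<phi>2 s * (\<kappa> t)^2 < 0)
        \<or> (\<phi>1 s < 0 \<and> \<phi>2 s < 0 \<and> (\<eta> t)^2 + \<phi>1 s * (vartheta t)^2 > 0 \<and> (\<eta> t)^2 + \<phi>1 s * (vartheta t)^2 + \<phi>2 s * (\<kappa> t)^2 > 0))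
         \<longrightarrow> alg_isomorphic (E3_st \<eta> vartheta \<kappa> \<phi>1 \<phi>2 s t) E9)) \<and>
   (\<eta> t = 0 \<and> vartheta t \<noteq> 0 \<longrightarrow>
      (\<phi>2 s \<noteq> 0 \<and> \<kappa> t \<noteq> 0 \<and> \<phi>1 s > 0 \<and> \<phi>1 s * (vartheta t)^2 + \<phi>2 s * (\<kappa> t)^2 = 0
         \<longrightarrow> alg_isomorphic (E3_st \<eta> vartheta \<kappa> \<phi>1 \<phi>2 s t) E2) \<and>
      (\<phi>2 s \<noteq> 0 \<and> \<kappa> t \<noteq> 0 \<and> \<phi>1 s < 0 \<and> \<phi>1 s * (vartheta t)^2 + \<phi>2 s * (\<kappa> t)^2 = 0
         \<longrightarrow> alg_isomorphic (E3_st \<eta> vartheta \<kappa> \<phi>1 \<phi>2 s t) E3) \<and>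
      (((\<phi>2 s = 0 \<and> \<phi>1 s > 0)
        \<or> (\<phi>1 s = 0 \<and> \<kappa> t \<noteq> 0 \<and> \<phi>2 s > 0))
         \<longrightarrow> alg_isomorphic (E3_st \<eta> vartheta \<kappa> \<phi>1 \<phi>2 s t) E5) \<and>
      (((\<phi>2 s = 0 \<and> \<phi>1 s < 0)
        \<or> (\<phi>1 s = 0 \<and> \<kappa> t \<noteq> 0 \<and> \<phi>2 s < 0))
         \<longrightarrow> alg_isomorphic (E3_st \<eta> vartheta \<kappa> \<phi>1 \<phi>2 s t) E6) \<and>
      (\<phi>1 s > 0 \<and> \<phi>2 s > 0
         \<longrightarrow> alg_isomorphic (E3_st \<eta> vartheta \<kappa> \<phi>1 \<phi>2 s t) E7) \<and>
      (((\<phi>1 s < 0 \<and> \<phi>2 s < 0)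
        \<or> (\<phi>1 s * (vartheta t)^2 + \<phi>2 s * (\<kappa> t)^2 > 0 \<and> \<phi>1 s * \<phi>2 s < 0))
         \<longrightarrow> alg_isomorphic (E3_st \<eta> vartheta \<kappa> \<phi>1 \<phi>2 s t) E8) \<and>
      (\<phi>1 s * (vartheta t)^2 + \<phi>2 s * (\<kappa> t)^2 < 0 \<and> \<phi>1 s * \<phi>2 s < 0
         \<longrightarrow> alg_isomorphic (E3_st \<eta> vartheta \<kappa> \<phi>1 \<phi>2 s t) E9) \<and>
      (\<phi>1 s = 0 \<and> \<phi>2 s = 0
         \<longrightarrow> alg_isomorphic (E3_st \<eta> vartheta \<kappa> \<phi>1 \<phi>2 s t) E10) \<and>
      (\<phi>1 s = 0 \<and> \<kappa> t = 0 \<and> \<phi>2 s > 0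
         \<longrightarrow> alg_isomorphic (E3_st \<eta> vartheta \<kappa> \<phi>1 \<phi>2 s t) E11) \<and>
      (\<phi>1 s = 0 \<and> \<kappa> t = 0 \<and> \<phi>2 s < 0
         \<longrightarrow> alg_isomorphic (E3_st \<eta> vartheta \<kappa> \<phi>1 \<phi>2 s t) E12))"
proof -
  let ?I = "alg_isomorphic (E3_st \<eta> vartheta \<kappa> \<phi>1 \<phi>2 s t)"
  let ?p = "\<phi>1 s" and ?q = "\<phi>2 s" and ?a = "\<eta> t" and ?b = "vartheta t" and ?c = "\<kappa> t"
  let ?Q = "?a\<^sup>2 + ?p * ?b\<^sup>2 + ?q * ?c\<^sup>2"
  have iso: "?I m" if "alg_isomorphic (rank_one3 1 ?p ?q ?a ?b ?c) m" for m :: "real^3 \<Rightarrow> real^3 \<Rightarrow> real^3"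
  proof -
    define k where "k = theta \<eta> vartheta \<kappa> \<phi>1 \<phi>2 s"
    have "k \<noteq> 0"
      using assms(3) by (simp add: k_def theta_def)
    have "E3_st \<eta> vartheta \<kappa> \<phi>1 \<phi>2 s t = rank_one3 (k * 1) (k * ?p) (k * ?q) ?a ?b ?c"
      unfolding E3_st_def M3_st_def evolution_mult_eq_rank_one3[symmetric] k_def
      by (rule arg_cong[of _ _ evolution_mult]) (simp add: vec_eq_iff forall_3)
    then show ?thesis
      using alg_isomorphic_trans[OF rank_one3_scale_form[OF \<open>k \<noteq> 0\<close>] that] by simp
  qed
  have iso_swap: "?I m" if "alg_isomorphic (rank_one3 1 ?q ?p ?a ?c ?b) m" for m :: "real^3 \<Rightarrow> real^3 \<Rightarrow> real^3"
    using iso alg_isomorphic_trans[OF rank_one3_swap23 that] by blast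
  have E1: "?I E1" if "?a \<noteq> 0" "?Q = 0" "?p = 0 \<or> ?q = 0"
    using that iso[of E1] iso_swap[of E1] iso_E1[of 1 ?a ?p ?b ?c] iso_E1[of 1 ?a ?q ?c ?b] by auto
  \<comment> \<open>Both isomorphisms come at once from the free scale of v. If \<eta>(t) = 0, the
    first two basis vectors are swapped to make the leading coordinate nonzero.\<close>
  have E23: "?I E2 \<and> ?I E3" if "?Q = 0" "?p \<noteq> 0" "?q \<noteq> 0" "?a \<noteq> 0 \<or> ?b \<noteq> 0"
  proof (cases "?a = 0")
    case True
    then show ?thesis
      using that iso_E2_E3[of ?p ?b 1 ?a ?q ?c]
        alg_isomorphic_trans[OF rank_one3_swap12, of ?p 1 ?q ?b ?a ?c]
      by (intro conjI iso) (simp_all add: add.commute)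
  next
    case False
    then show ?thesis
      using that iso_E2_E3[of 1 ?a ?p ?b ?q ?c] by (intro conjI iso) simp_all
  qed
  \<comment> \<open>The sign 0, 1 or -1 in the third place gives \<open>E4\<close>,
    \<open>E5\<close> or \<open>E6\<close>; likewise for \<open>degen_q\<close>.\<close>
  have degen_p: "?I (rank_one3 1 0 (sgn ?q) 1 0 0)" if "?p = 0" "?Q \<noteq> 0"
    using that iso_swap iso_nonisotropic_degenerate[of 1 ?a ?q ?c ?b] by simp
  have degen_q: "?I (rank_one3 1 0 (sgn ?p) 1 0 0)" if "?q = 0" "?Q \<noteq> 0"
    using that iso iso_nonisotropic_degenerate[of 1 ?a ?p ?b ?c] by simp
  have E7: "?I E7" if "?p > 0" "?q > 0" "?a \<noteq> 0 \<or> ?b \<noteq> 0"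
  proof -
    have "?Q > 0"
      using that
      by (smt (verit) mult_nonneg_nonneg mult_pos_pos zero_le_power2 zero_less_power2)
    then show ?thesis
      using that by (intro iso iso_E7) simp_all
  qed
  have E8: "?I E8" if "?p * ?q * ?Q < 0"
    using that by (intro iso iso_E8) simp
  \<comment> \<open>The first diagonal entry is 1, so a positive definite B / B(v, v) would force
    \<open>?Q\<close>, \<open>?p\<close> and \<open>?q\<close> to be positive.\<close>
  have E9: "?I E9" if "?p * ?q * ?Q > 0" "?p < 0 \<or> ?q < 0"
    using that by (intro iso iso_E9) (auto simp: zero_less_mult_iff)
  have radical: "?I (rank_one3 0 1 (sgn ?q) 1 0 0)" if "?a = 0" "?p = 0" "?b \<noteq> 0" "?q * ?c = 0"
    using that iso iso_radical[of 1 ?b ?q ?c] by simp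
  have sqb: "?p * ?b\<^sup>2 < 0" if "?p < 0" "?b \<noteq> 0"
    using that by (simp add: mult_neg_pos)
  have sqc_nonneg: "?q * ?c\<^sup>2 \<ge> 0" if "?q \<ge> 0"
    using that by simp
  have sqc_nonpos: "?q * ?c\<^sup>2 \<le> 0" if "?q \<le> 0"
    using that by (simp add: mult_nonpos_nonneg)
  show ?thesis
  \<comment> \<open>Goals 1 to 3 belong to nonzero \<eta>(t) and \<open>?Q\<close> = 0, goals 4 to 9
    to nonzero \<eta>(t) and \<open>?Q\<close>, goals 10 to 19 to \<eta>(t) = 0.\<close>
  proof (intro conjI impI, goal_cases)
    case 1 then show ?case using E1 by auto
  next
    case 2 then show ?case using E23 by auto
  next
    case 3 then show ?case using E23 by auto
  next
    case 4 then show ?case using degen_p by (simp add: E4_eq)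
  next
    case 5 then show ?case using degen_p degen_q by (auto simp: E5_eq)
  next
    case 6 then show ?case using degen_p degen_q by (auto simp: E6_eq)
  next
    case 7 then show ?case using E7 by simp
  next
    case 8
    \<comment> \<open>All six alternatives lead to a negative \<open>?p * ?q * ?Q\<close>. In the
      last one \<open>?p\<close> is negative and \<open>?Q\<close> reduces to
      \<open>?q * ?c\<^sup>2\<close>, which has the sign of \<open>?q\<close>.\<close>
    have "?p * ?q < 0 \<and> ?Q > 0 \<or> ?p * ?q > 0 \<and> ?Q < 0"
    proof (cases "?a\<^sup>2 + ?p * ?b\<^sup>2 = 0")
      case True
      have "?p < 0"
        using True 8 by (smt (verit) zero_less_power2 mult_nonneg_nonneg zero_le_power2)
      moreover have "?q * ?c\<^sup>2 \<noteq> 0"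
        using True 8 by simp
      ultimately show ?thesis
        using True by (auto simp: mult_less_0_iff zero_less_mult_iff linorder_neq_iff)
    next
      case False
      then show ?thesis
        using 8 sqc_nonneg sqc_nonpos by (smt (verit, best) mult_neg_neg mult_neg_pos mult_pos_neg)
    qed
    then show ?case
      using E8 by (auto simp: mult_less_0_iff)
  next
    case 9
    then have "?p * ?q * ?Q > 0" "?p < 0 \<or> ?q < 0"
      by (auto simp: zero_less_mult_iff mult_less_0_iff)
    then show ?case using E9 by blast
  next
    case 10 then show ?case using E23 by auto
  next
    case 11 then show ?case using E23 by auto
  next
    case 12 then show ?case using degen_p degen_q by (auto simp: E5_eq)
  next
    case 13 then show ?case using degen_p degen_q by (auto simp: E6_eq)
  next
    case 14 then show ?case using E7 by simp
  next
    case 15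
    \<comment> \<open>If both coefficients are negative, \<open>?Q\<close> is strictly negative
      because vartheta(t) \<noteq> 0.\<close>
    then have "?p * ?q < 0 \<and> ?Q > 0 \<or> ?p * ?q > 0 \<and> ?Q < 0"
      using sqb sqc_nonpos by (auto simp: zero_less_mult_iff)
    then show ?case
      using E8 by (auto simp: mult_less_0_iff)
  next
    case 16 then show ?case
      using E9 by (auto simp: zero_less_mult_iff mult_less_0_iff)
  next
    case 17
    then have "?I (rank_one3 0 1 0 1 0 0)"
      using radical by simp
    \<comment> \<open>\<open>E10\<close> carries its nonzero coefficient in the third place.\<close>
    then have "?I (rank_one3 0 0 1 1 0 0)"
      using alg_isomorphic_trans[OF _ rank_one3_swap23] by blast
    then show ?case by (simp add: E10_eq)
  next
    case 18 then show ?case using radical by (simp add: E11_eq)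
  next
    case 19 then show ?case using radical by (simp add: E12_eq)
  qed
qed

end
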